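(* Every Cayley graph has a short spanning factorization. That is, if $\Gamma$ is a finite group, $\Delta\subseteq\Gamma$ is a subset generating $\Gamma$ and not containing the identity, then the directed graph with vertex set $\Gamma$ and edge set $\{(g,g\delta): g\in\Gamma,\ \delta\in\Delta\}$ has a spanning factorization which is short.
   Context: A 1-factor of a directed graph $G$ is a (spanning) subgraph in which every vertex has in-degree and out-degree equal to 1. A 1-factoring of a directed graph with all in-degrees and out-degrees equal to $d$ is a decomposition of its edge set into $d$ edge-disjoint 1-factors $F_1,\dots,F_d$. A word is a finite string of symbols from $\{F_1,\dots,F_d\}$. If $v$ is a vertex and $\omega$ is a word, $v\omega$ denotes the directed path (and also its endpoint) starting at $v$ and following successively, for each consecutive symbol of $\omega$, the unique edge of that factor leaving the current vertex. If $G$ has $n$ vertices, a 1-factoring together with a set of $n$ words $W=\{\omega_0,\omega_1,\dots,\omega_{n-1}\}$ with $\omega_0=\emptyset$ is a spanning factorization of $G$ (with word list $W$) if for every vertex $v$ the vertices $v\omega_0,\dots,v\omega_{n-1}$ are distinct. Let $|\{F_i:F_i\in W\}|$ denote the total number of occurrences (with multiplicity) of the symbol $F_i$ in the words of $W$. Let $N_k$ be the number of ordered pairs $(u,w)$ of vertices such that the directed distance from $u$ to $w$ is $k$, and let $D$ be the diameter of $G$. A spanning factorization is short if $$\left\lceil \sum_{i=1}^{d} |\{F_i : F_i \in W\}| / d \right\rceil = \left\lceil \sum_{k=1}^{D} \frac{kN_k}{nd} \right\rceil .$$ *)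

theory Defs
  imports
    "HOL-Algebra.Generated_Groups"
    "HOL-Library.Disjoint_Sets"
    "Graph_Theory.Digraph_Component"
    "Graph_Theory.Pair_Digraph"
    "Graph_Theory.Shortest_Path"
begin

definition cayley_digraph :: "('g, 'm) monoid_scheme \<Rightarrow> 'g set \<Rightarrow> ('g, 'g \<times> 'g) pre_digraph" where
  "cayley_digraph \<Gamma> \<Delta> = with_proj
     \<lparr> pverts = carrier \<Gamma>,
       parcs = {(g, g \<otimes>\<^bsub>\<Gamma>\<^esub> \<delta>) | g \<delta>. g \<in> carrier \<Gamma> \<and> \<delta> \<in> \<Delta>} \<rparr>"

definition regular_digraph :: "('a, 'b) pre_digraph \<Rightarrow> nat \<Rightarrow> bool" where
  "regular_digraph G d \<longleftrightarrow> (\<forall>v\<in>verts G. in_degree G v = d \<and> out_degree G v = d)"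

definition one_factor :: "('a, 'b) pre_digraph \<Rightarrow> ('a, 'b) pre_digraph \<Rightarrow> bool" where
  "one_factor H G \<longleftrightarrow> spanning H G \<and> regular_digraph H 1"

text \<open>The factors are \<open>F 1, \<dots>, F d\<close>; values of \<open>F\<close> at other indices are irrelevant.\<close>

definition one_factoring ::
  "('a, 'b) pre_digraph \<Rightarrow> nat \<Rightarrow> (nat \<Rightarrow> ('a, 'b) pre_digraph) \<Rightarrow> bool" where
  "one_factoring G d F \<longleftrightarrow>
     fin_digraph G \<and> regular_digraph G d \<and>
     (\<forall>i\<in>{1..d}. one_factor (F i) G) \<and>
     disjoint_family_on (\<lambda>i. arcs (F i)) {1..d} \<and>
     (\<Union>i\<in>{1..d}. arcs (F i)) = arcs G"

text \<open>
  A word is a list of indices in \<open>{1..d}\<close>, the index \<open>i\<close> standing for the symbol \<open>F i\<close>.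
  The end vertex of the path that starts at \<open>v\<close> and follows the word \<open>\<omega>\<close>:
  the description operator is applied only where a factor has exactly one arc leaving \<open>v\<close>.
\<close>

primrec follow :: "(nat \<Rightarrow> ('a, 'b) pre_digraph) \<Rightarrow> 'a \<Rightarrow> nat list \<Rightarrow> 'a" where
  "follow F v [] = v"
| "follow F v (i # \<omega>) = follow F (head (F i) (THE e. e \<in> out_arcs (F i) v)) \<omega>"

text \<open>The word list is \<open>w 0, \<dots>, w (n - 1)\<close>, where \<open>n\<close> is the number of vertices.\<close>

definition spanning_factorization ::
  "('a, 'b) pre_digraph \<Rightarrow> nat \<Rightarrow> (nat \<Rightarrow> ('a, 'b) pre_digraph) \<Rightarrow> (nat \<Rightarrow> nat list) \<Rightarrow> bool" where
  "spanning_factorization G d F w \<longleftrightarrow>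
     one_factoring G d F \<and>
     w 0 = [] \<and>
     (\<forall>j<card (verts G). set (w j) \<subseteq> {1..d}) \<and>
     (\<forall>v\<in>verts G. inj_on (\<lambda>j. follow F v (w j)) {..<card (verts G)})"

definition symbol_count :: "nat \<Rightarrow> (nat \<Rightarrow> nat list) \<Rightarrow> nat \<Rightarrow> nat" where
  "symbol_count n w i = (\<Sum>j<n. count_list (w j) i)"

definition digraph_dist :: "('a, 'b) pre_digraph \<Rightarrow> 'a \<Rightarrow> 'a \<Rightarrow> ereal" where
  "digraph_dist G u v = wf_digraph.\<mu> G (\<lambda>_. 1) u v"

definition diameter :: "('a, 'b) pre_digraph \<Rightarrow> ereal" where
  "diameter G = (SUP u\<in>verts G. SUP v\<in>verts G. digraph_dist G u v)"

definition pairs_at_dist :: "('a, 'b) pre_digraph \<Rightarrow> nat \<Rightarrow> nat" where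
  "pairs_at_dist G k =
     card {(u, v). u \<in> verts G \<and> v \<in> verts G \<and> digraph_dist G u v = ereal (real k)}"

text \<open>
  Shortness presupposes a finite diameter. For \<open>d = 0\<close> (the one-vertex digraph without arcs)
  both sums are empty and both sides of the equation are \<open>0\<close>.
\<close>

definition short_word_list :: "('a, 'b) pre_digraph \<Rightarrow> nat \<Rightarrow> (nat \<Rightarrow> nat list) \<Rightarrow> bool" where
  "short_word_list G d w \<longleftrightarrow>
     (let n = card (verts G) in
      \<exists>D. diameter G = ereal (real D) \<and>
        \<lceil>\<Sum>i=1..d. real (symbol_count n w i) / real d\<rceil> =
        \<lceil>\<Sum>k=1..D. real (k * pairs_at_dist G k) / real (n * d)\<rceil>)"

end

theory Submission
  imports Defs "HOL-Algebra.Multiplicative_Group"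
begin

text \<open>
  Left translations are automorphisms of a Cayley digraph, and they do not only preserve its arcs:
  they preserve the generator that labels each arc. Two consequences give the theorem.

  First, right multiplication by a generator \<open>\<delta>\<close> is a permutation of the group, so that the arcs
  labelled \<open>\<delta>\<close> form a 1-factor and the labels decompose the digraph into \<open>d = |\<Delta>|\<close> 1-factors. A word
  in the factors has a value in the group, and following it from \<open>v\<close> multiplies \<open>v\<close> on the right by
  that value (\<open>follow_factors\<close>). Hence any choice of one word for each group element, with
  the empty word for the identity, is a spanning word list: cancelling \<open>v\<close> shows that distinct elements lead to distinct end vertices
  (\<open>spanning_factorization_shortest_words\<close>).

  Second, the distance from \<open>u\<close> to \<open>v\<close> is the word norm of \<open>u\<inverse>v\<close>, the least length of a word with
  this value (\<open>digraph_dist_cayley\<close>). Words are chosen of least length, so that the total number of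
  symbols is the sum of the word norms of all elements. Each element is \<open>u\<inverse>v\<close> for exactly \<open>n\<close> pairs
  \<open>(u, v)\<close>, so that this total is \<open>\<Sum>k. k * N\<^sub>k / n\<close> (\<open>pairs_at_dist_cayley\<close>).
  The two quantities in the definition of shortness therefore agree even before rounding.

  A word uses generators only, whereas a subgroup is generated by inverses as well. In a finite group
  the inverse of a generator is one of its powers, and so every element is the value of a word.
\<close>

section \<open>Words in the generators of a finite group\<close>

text \<open>
  The symbol \<open>i\<close> of a word stands for a 1-factor, hence for the generator \<open>s i\<close> that labels its arcs.
  Fixing the enumeration \<open>s\<close> of the generating set lets words be lists of indices.
\<close>

locale enumerated_generators = group \<Gamma> for \<Gamma> :: "('g, 'm) monoid_scheme" (structure) +
  fixes \<Delta> :: "'g set" and d :: nat and s :: "nat \<Rightarrow> 'g"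
  assumes finite_carrier: "finite (carrier \<Gamma>)"
    and generators_closed: "\<Delta> \<subseteq> carrier \<Gamma>"
    and generate_generators: "generate \<Gamma> \<Delta> = carrier \<Gamma>"
    and bij_s: "bij_betw s {1..d} \<Delta>"
begin

(* Simplification would turn {1..d} into {Suc 0..d}, which the facts below do not match. *)
declare One_nat_def [simp del]

lemma image_s: "s ` {1..d} = \<Delta>"
  using bij_s by (simp add: bij_betw_def)

lemma s_generator: "i \<in> {1..d} \<Longrightarrow> s i \<in> \<Delta>"
  using image_s by blast

lemma s_closed: "i \<in> {1..d} \<Longrightarrow> s i \<in> carrier \<Gamma>"
  using s_generator generators_closed by blast

lemma generatorE:
  assumes "\<delta> \<in> \<Delta>"
  obtains i where "i \<in> {1..d}" "\<delta> = s i"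
  using assms image_s by blast

abbreviation words :: "nat list set" where
  "words \<equiv> {\<omega>. set \<omega> \<subseteq> {1..d}}"

primrec word_value :: "nat list \<Rightarrow> 'g" where
  "word_value [] = \<one>"
| "word_value (i # \<omega>) = s i \<otimes> word_value \<omega>"

lemma word_value_closed: "\<omega> \<in> words \<Longrightarrow> word_value \<omega> \<in> carrier \<Gamma>"
  by (induction \<omega>) (auto intro!: m_closed s_closed)

lemma word_value_append:
  "\<omega> \<in> words \<Longrightarrow> \<upsilon> \<in> words \<Longrightarrow> word_value (\<omega> @ \<upsilon>) = word_value \<omega> \<otimes> word_value \<upsilon>"
  by (induction \<omega>) (simp_all add: m_assoc s_closed word_value_closed)

lemma word_value_replicate:
  "i \<in> {1..d} \<Longrightarrow> word_value (replicate k i) = s i [^] k"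
  by (induction k)
    (simp_all only: replicate.simps word_value.simps nat_pow_0 nat_pow_Suc2 s_closed)

lemma ex_word:
  assumes "g \<in> carrier \<Gamma>"
  shows "\<exists>\<omega>\<in>words. word_value \<omega> = g"
proof -
  have "g \<in> generate \<Gamma> \<Delta>"
    using assms generate_generators by simp
  then show ?thesis
  proof (induction rule: generate.induct)
    case one
    show ?case by (rule bexI[of _ "[]"]) simp_all
  next
    case (incl h)
    then obtain i where "i \<in> {1..d}" "h = s i" by (blast elim: generatorE)
    then show ?case
      by (intro bexI[of _ "[i]"]) (simp_all add: s_closed)
  next
    case (inv h)
    then obtain i where i: "i \<in> {1..d}" "h = s i" by (blast elim: generatorE)
    \<comment> \<open>The order \<open>n\<close> of the group annihilates \<open>s i\<close>, so its inverse is the power \<open>n - 1\<close>.\<close>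
    have "s i [^] (order \<Gamma> - 1) \<otimes> s i = s i [^] Suc (order \<Gamma> - 1)"
      by simp
    also have "\<dots> = \<one>"
      using i finite_carrier order_gt_0_iff_finite pow_order_eq_1 s_closed by simp
    finally have "inv (s i) = s i [^] (order \<Gamma> - 1)"
      using i s_closed by (intro inv_equality) auto
    then show ?case
      using i
      by (intro bexI[of _ "replicate (order \<Gamma> - 1) i"])
        (simp_all only: word_value_replicate mem_Collect_eq set_replicate_conv_if, auto)
  next
    case (eng h1 h2)
    then obtain \<omega> \<upsilon> where "\<omega> \<in> words" "\<upsilon> \<in> words" "word_value \<omega> = h1" "word_value \<upsilon> = h2"
      by blast
    then show ?case
      by (intro bexI[of _ "\<omega> @ \<upsilon>"]) (simp_all add: word_value_append)
  qed
qed

definition shortest_word :: "'g \<Rightarrow> nat list" where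
  "shortest_word g = arg_min length (\<lambda>\<omega>. \<omega> \<in> words \<and> word_value \<omega> = g)"

abbreviation word_norm :: "'g \<Rightarrow> nat" where
  "word_norm g \<equiv> length (shortest_word g)"

lemma shortest_word:
  assumes "g \<in> carrier \<Gamma>"
  shows "set (shortest_word g) \<subseteq> {1..d}" and "word_value (shortest_word g) = g"
proof -
  obtain \<omega> where "\<omega> \<in> words \<and> word_value \<omega> = g"
    using ex_word[OF assms] by blast
  then have "shortest_word g \<in> words \<and> word_value (shortest_word g) = g"
    unfolding shortest_word_def by (rule arg_min_natI)
  then show "set (shortest_word g) \<subseteq> {1..d}" "word_value (shortest_word g) = g"
    by simp_all
qed

lemma word_norm_le: "\<omega> \<in> words \<Longrightarrow> word_norm (word_value \<omega>) \<le> length \<omega>"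
  unfolding shortest_word_def by (rule arg_min_nat_le) simp

lemma shortest_word_one: "shortest_word \<one> = []"
  using word_norm_le[of "[]"] by simp

section \<open>The generators as 1-factors\<close>

abbreviation \<C> :: "('g, 'g \<times> 'g) pre_digraph" where
  "\<C> \<equiv> cayley_digraph \<Gamma> \<Delta>"

abbreviation factors :: "nat \<Rightarrow> ('g, 'g \<times> 'g) pre_digraph" where
  "factors i \<equiv> cayley_digraph \<Gamma> {s i}"

lemma cayley_digraph_simps:
  "verts (cayley_digraph \<Gamma> A) = carrier \<Gamma>"
  "arcs (cayley_digraph \<Gamma> A) = {(g, g \<otimes> \<delta>) | g \<delta>. g \<in> carrier \<Gamma> \<and> \<delta> \<in> A}"
  "tail (cayley_digraph \<Gamma> A) = fst"
  "head (cayley_digraph \<Gamma> A) = snd"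
  by (simp_all add: cayley_digraph_def)

lemma fin_digraph_cayley:
  assumes "A \<subseteq> carrier \<Gamma>"
  shows "fin_digraph (cayley_digraph \<Gamma> A)"
proof
  show "finite (verts (cayley_digraph \<Gamma> A))"
    by (simp add: cayley_digraph_simps finite_carrier)
  have "arcs (cayley_digraph \<Gamma> A) \<subseteq> carrier \<Gamma> \<times> carrier \<Gamma>"
    using assms by (auto simp: cayley_digraph_simps)
  then show "finite (arcs (cayley_digraph \<Gamma> A))"
    by (rule finite_subset) (simp add: finite_carrier)
qed (use assms in \<open>auto simp: cayley_digraph_simps\<close>)

lemma out_arcs_cayley:
  assumes "v \<in> carrier \<Gamma>"
  shows "out_arcs (cayley_digraph \<Gamma> A) v = (\<lambda>\<delta>. (v, v \<otimes> \<delta>)) ` A"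
  using assms by (auto simp: out_arcs_def cayley_digraph_simps)

lemma in_arcs_cayley:
  assumes "v \<in> carrier \<Gamma>" and "A \<subseteq> carrier \<Gamma>"
  shows "in_arcs (cayley_digraph \<Gamma> A) v = (\<lambda>\<delta>. (v \<otimes> inv \<delta>, v)) ` A"
proof -
  have "g = v \<otimes> inv \<delta> \<longleftrightarrow> v = g \<otimes> \<delta>" if "g \<in> carrier \<Gamma>" "\<delta> \<in> A" for g \<delta>
    using that assms by (intro inv_solve_right) auto
  moreover have "v \<otimes> inv \<delta> \<in> carrier \<Gamma>" if "\<delta> \<in> A" for \<delta>
    using that assms by auto
  ultimately have "e \<in> in_arcs (cayley_digraph \<Gamma> A) v \<longleftrightarrow> e \<in> (\<lambda>\<delta>. (v \<otimes> inv \<delta>, v)) ` A" for e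
    unfolding in_arcs_def cayley_digraph_simps by (cases e) (auto simp: image_iff)
  then show ?thesis
    by blast
qed

lemma regular_cayley:
  assumes "A \<subseteq> carrier \<Gamma>"
  shows "regular_digraph (cayley_digraph \<Gamma> A) (card A)"
  unfolding regular_digraph_def
proof
  fix v assume "v \<in> verts (cayley_digraph \<Gamma> A)"
  then have v: "v \<in> carrier \<Gamma>"
    by (simp add: cayley_digraph_simps)
  have "inj_on (\<lambda>\<delta>. (v \<otimes> inv \<delta>, v)) A" "inj_on (\<lambda>\<delta>. (v, v \<otimes> \<delta>)) A"
    using v assms inj_on_subset[OF inv_inj assms] by (auto simp: inj_on_def subset_iff)
  then show "in_degree (cayley_digraph \<Gamma> A) v = card A \<and> out_degree (cayley_digraph \<Gamma> A) v = card A"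
    using v assms
    by (simp add: in_degree_def out_degree_def in_arcs_cayley out_arcs_cayley card_image)
qed

lemma one_factor_cayley_singleton:
  assumes "A \<subseteq> carrier \<Gamma>" and "\<delta> \<in> A"
  shows "one_factor (cayley_digraph \<Gamma> {\<delta>}) (cayley_digraph \<Gamma> A)"
proof -
  have "wf_digraph (cayley_digraph \<Gamma> A)" "wf_digraph (cayley_digraph \<Gamma> {\<delta>})"
    using assms by (auto intro!: fin_digraph.axioms(1) fin_digraph_cayley)
  then show ?thesis
    using regular_cayley[of "{\<delta>}"] assms
    by (auto simp: One_nat_def one_factor_def spanning_def subgraph_def compatible_def
        cayley_digraph_simps)
qed

lemma one_factoring_cayley: "one_factoring \<C> d factors"
proof -
  have "card \<Delta> = d"
    using bij_betw_same_card[OF bij_s] by simp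
  then have "regular_digraph \<C> d"
    using regular_cayley[OF generators_closed] by simp
  moreover have "disjoint_family_on (\<lambda>i. arcs (factors i)) {1..d}"
    unfolding disjoint_family_on_def
  proof (intro ballI impI)
    fix i j assume ij: "i \<in> {1..d}" "j \<in> {1..d}" "i \<noteq> j"
    then have "s i \<noteq> s j"
      using inj_onD[OF bij_betw_imp_inj_on[OF bij_s]] by blast
    then show "arcs (factors i) \<inter> arcs (factors j) = {}"
      using ij(1,2) s_closed by (auto simp: cayley_digraph_simps)
  qed
  moreover have "(\<Union>i\<in>{1..d}. arcs (factors i)) = arcs \<C>"
    unfolding image_s[symmetric] by (auto simp: cayley_digraph_simps)
  ultimately show ?thesis
    using fin_digraph_cayley[OF generators_closed]
      one_factor_cayley_singleton[OF generators_closed s_generator]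
    by (simp add: one_factoring_def)
qed

lemma follow_factors:
  assumes "v \<in> carrier \<Gamma>" and "\<omega> \<in> words"
  shows "follow factors v \<omega> = v \<otimes> word_value \<omega>"
  using assms
proof (induction \<omega> arbitrary: v)
  case (Cons i \<omega>)
  have "out_arcs (factors i) v = {(v, v \<otimes> s i)}"
    using Cons.prems by (simp add: out_arcs_cayley)
  then have "follow factors v (i # \<omega>) = follow factors (v \<otimes> s i) \<omega>"
    by (simp add: cayley_digraph_simps)
  also have "\<dots> = v \<otimes> s i \<otimes> word_value \<omega>"
    using Cons by (simp add: s_closed)
  finally show ?case
    using Cons.prems by (simp add: m_assoc s_closed word_value_closed)
qed simp

lemma spanning_factorization_shortest_words:
  assumes "bij_betw h {..<card (carrier \<Gamma>)} (carrier \<Gamma>)" and "h 0 = \<one>"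
  shows "spanning_factorization \<C> d factors (\<lambda>j. shortest_word (h j))"
proof -
  have h: "h j \<in> carrier \<Gamma>" if "j < card (carrier \<Gamma>)" for j
    using that assms(1) by (auto simp: bij_betw_def)
  have "inj_on (\<lambda>j. follow factors v (shortest_word (h j))) {..<card (carrier \<Gamma>)}"
    if v: "v \<in> carrier \<Gamma>" for v
  proof (rule inj_onI)
    fix i j
    assume ij: "i \<in> {..<card (carrier \<Gamma>)}" "j \<in> {..<card (carrier \<Gamma>)}"
      and eq: "follow factors v (shortest_word (h i)) = follow factors v (shortest_word (h j))"
    then have "v \<otimes> h i = v \<otimes> h j"
      using v h by (simp add: follow_factors shortest_word)
    then have "h i = h j"
      using v h ij by simp
    then show "i = j"
      using assms(1) ij by (auto simp: bij_betw_def dest: inj_onD)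
  qed
  then show ?thesis
    using h one_factoring_cayley assms(2) shortest_word(1)
    by (simp add: spanning_factorization_def cayley_digraph_simps shortest_word_one)
qed

section \<open>Distances as word norms\<close>

lemma wf_digraph_cayley: "wf_digraph \<C>"
  using fin_digraph_cayley[OF generators_closed] by (rule fin_digraph.axioms(1))

lemma awalk_of_word:
  assumes "u \<in> carrier \<Gamma>" and "\<omega> \<in> words"
  shows "\<exists>p. pre_digraph.awalk \<C> u p (u \<otimes> word_value \<omega>) \<and> length p = length \<omega>"
proof -
  interpret wf_digraph \<C> by (rule wf_digraph_cayley)
  show ?thesis
    using assms
  proof (induction \<omega> arbitrary: u)
    case Nil
    then have "awalk u [] (u \<otimes> word_value [])"
      by (simp add: awalk_Nil_iff cayley_digraph_simps)
    then show ?case by auto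
  next
    case (Cons i \<omega>)
    have si: "s i \<in> carrier \<Gamma>" "\<omega> \<in> words"
      using Cons.prems s_closed by auto
    obtain p where p: "awalk (u \<otimes> s i) p (u \<otimes> s i \<otimes> word_value \<omega>)" "length p = length \<omega>"
      using Cons.IH[of "u \<otimes> s i"] Cons.prems si by auto
    have "(u, u \<otimes> s i) \<in> arcs \<C>"
      using Cons.prems s_generator by (auto simp: cayley_digraph_simps)
    then have "awalk u ((u, u \<otimes> s i) # p) (u \<otimes> word_value (i # \<omega>))"
      using p Cons.prems si
      by (simp add: awalk_Cons_iff cayley_digraph_simps m_assoc word_value_closed)
    then show ?case
      using p(2) by (intro exI[of _ "(u, u \<otimes> s i) # p"]) simp
  qed
qed

lemma word_of_awalk:
  assumes "pre_digraph.awalk \<C> u p v"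
  shows "\<exists>\<omega>\<in>words. u \<otimes> word_value \<omega> = v \<and> length \<omega> = length p"
proof -
  interpret wf_digraph \<C> by (rule wf_digraph_cayley)
  show ?thesis
    using assms
  proof (induction p arbitrary: u)
    case Nil
    then show ?case
      by (intro bexI[of _ "[]"]) (auto simp: awalk_Nil_iff cayley_digraph_simps)
  next
    case (Cons e p)
    have e: "e \<in> arcs \<C>" "fst e = u" "awalk (snd e) p v"
      using Cons.prems by (simp_all add: awalk_Cons_iff cayley_digraph_simps(3,4))
    then obtain \<delta> where "\<delta> \<in> \<Delta>" and \<delta>: "u \<in> carrier \<Gamma>" "e = (u, u \<otimes> \<delta>)"
      unfolding cayley_digraph_simps by force
    from \<open>\<delta> \<in> \<Delta>\<close> obtain i where i: "i \<in> {1..d}" "\<delta> = s i"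
      by (rule generatorE)
    then have "awalk (u \<otimes> s i) p v"
      using e \<delta> by simp
    then obtain \<omega> where \<omega>: "\<omega> \<in> words" "u \<otimes> s i \<otimes> word_value \<omega> = v" "length \<omega> = length p"
      using Cons.IH by blast
    then show ?case
      using i \<delta>(1) s_closed
      by (intro bexI[of _ "i # \<omega>"]) (auto simp: m_assoc word_value_closed)
  qed
qed

lemma digraph_dist_cayley:
  assumes "u \<in> carrier \<Gamma>" and "v \<in> carrier \<Gamma>"
  shows "digraph_dist \<C> u v = ereal (real (word_norm (inv u \<otimes> v)))"
proof -
  interpret wf_digraph \<C> by (rule wf_digraph_cayley)
  have cost: "awalk_cost (\<lambda>_. 1) p = real (length p)" for p
    by (induction p) simp_all
  have g: "inv u \<otimes> v \<in> carrier \<Gamma>" "u \<otimes> (inv u \<otimes> v) = v"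
    using assms by (simp_all add: m_assoc[symmetric])
  have "(INF p\<in>{p. awalk u p v}. ereal (awalk_cost (\<lambda>_. 1) p))
    = ereal (real (word_norm (inv u \<otimes> v)))"
  proof (rule antisym)
    obtain p where "awalk u p v" "length p = word_norm (inv u \<otimes> v)"
      using awalk_of_word[of u "shortest_word (inv u \<otimes> v)"] assms g shortest_word[OF g(1)] by auto
    then show "(INF p\<in>{p. awalk u p v}. ereal (awalk_cost (\<lambda>_. 1) p))
      \<le> ereal (real (word_norm (inv u \<otimes> v)))"
      by (intro INF_lower2[of p]) (simp_all add: cost)
  next
    show "ereal (real (word_norm (inv u \<otimes> v)))
      \<le> (INF p\<in>{p. awalk u p v}. ereal (awalk_cost (\<lambda>_. 1) p))"
    proof (rule INF_greatest)
      fix p assume "p \<in> {p. awalk u p v}"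
      then obtain \<omega> where \<omega>: "\<omega> \<in> words" "u \<otimes> word_value \<omega> = v" "length \<omega> = length p"
        using word_of_awalk by blast
      then have "word_value \<omega> = inv u \<otimes> v"
        using assms(1) word_value_closed by (auto simp: m_assoc[symmetric])
      then show "ereal (real (word_norm (inv u \<otimes> v))) \<le> ereal (awalk_cost (\<lambda>_. 1) p)"
        using word_norm_le[OF \<omega>(1)] \<omega>(3) by (simp add: cost)
    qed
  qed
  then show ?thesis
    by (simp add: digraph_dist_def \<mu>_def)
qed

text \<open>
  Vertex transitivity: \<open>(u, g) \<mapsto> (u, ug)\<close> carries the elements of norm \<open>k\<close>, one copy for each \<open>u\<close>,
  to the pairs at distance \<open>k\<close>.
\<close>

lemma pairs_at_dist_cayley:
  "pairs_at_dist \<C> k = card (carrier \<Gamma>) * card {g \<in> carrier \<Gamma>. word_norm g = k}"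
proof -
  have "{(u, v). u \<in> verts \<C> \<and> v \<in> verts \<C> \<and> digraph_dist \<C> u v = ereal (real k)}
    = {(u, v). u \<in> carrier \<Gamma> \<and> v \<in> carrier \<Gamma> \<and> word_norm (inv u \<otimes> v) = k}"
    by (auto simp: cayley_digraph_simps digraph_dist_cayley)
  moreover have "bij_betw (\<lambda>(u, g). (u, u \<otimes> g)) (carrier \<Gamma> \<times> {g \<in> carrier \<Gamma>. word_norm g = k})
    {(u, v). u \<in> carrier \<Gamma> \<and> v \<in> carrier \<Gamma> \<and> word_norm (inv u \<otimes> v) = k}"
    by (rule bij_betw_byWitness[where f' = "\<lambda>(u, v). (u, inv u \<otimes> v)"])
      (auto simp: m_assoc[symmetric])
  ultimately show ?thesis
    by (simp add: pairs_at_dist_def bij_betw_same_card[symmetric] card_cartesian_product)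
qed

text \<open>
  Fixing \<open>u = \<one>\<close> already realises every word norm as a distance, so the diameter is the largest norm.
\<close>

lemma diameter_cayley: "diameter \<C> = ereal (real (Max (word_norm ` carrier \<Gamma>)))"
proof -
  let ?D = "Max (word_norm ` carrier \<Gamma>)"
  have fin: "finite (word_norm ` carrier \<Gamma>)"
    by (simp add: finite_carrier)
  have "?D \<in> word_norm ` carrier \<Gamma>"
    using fin one_closed by (intro Max_in) auto
  then obtain g where g: "g \<in> carrier \<Gamma>" "word_norm g = ?D"
    by force
  show ?thesis
    unfolding diameter_def cayley_digraph_simps
  proof (rule antisym)
    show "(SUP u\<in>carrier \<Gamma>. SUP v\<in>carrier \<Gamma>. digraph_dist \<C> u v) \<le> ereal (real ?D)"
      using fin by (intro SUP_least) (simp add: digraph_dist_cayley)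
  next
    have "ereal (real ?D) = digraph_dist \<C> \<one> g"
      using g by (simp add: digraph_dist_cayley)
    also have "\<dots> \<le> (SUP u\<in>carrier \<Gamma>. SUP v\<in>carrier \<Gamma>. digraph_dist \<C> u v)"
      using g(1) by (intro SUP_upper2[of "\<one>"] SUP_upper) simp_all
    finally show "ereal (real ?D) \<le> (SUP u\<in>carrier \<Gamma>. SUP v\<in>carrier \<Gamma>. digraph_dist \<C> u v)" .
  qed
qed

section \<open>Counting symbols\<close>

lemma sum_symbol_count:
  assumes "\<And>j. j < n \<Longrightarrow> set (w j) \<subseteq> {1..d}"
  shows "(\<Sum>i=1..d. symbol_count n w i) = (\<Sum>j<n. length (w j))"
proof -
  have "(\<Sum>i=1..d. count_list (w j) i) = length (w j)" if "j < n" for j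
  proof -
    have "(\<Sum>i=1..d. count_list (w j) i) = (\<Sum>i\<in>set (w j). count_list (w j) i)"
      using assms[OF that] by (intro sum.mono_neutral_right) (auto simp: count_list_0_iff)
    then show ?thesis
      by (simp add: sum_count_set)
  qed
  then show ?thesis
    unfolding symbol_count_def by (subst sum.swap) simp
qed

lemma sum_word_norm:
  assumes "\<And>g. g \<in> carrier \<Gamma> \<Longrightarrow> word_norm g \<le> D"
  shows "(\<Sum>g\<in>carrier \<Gamma>. word_norm g)
    = (\<Sum>k=1..D. k * card {g \<in> carrier \<Gamma>. word_norm g = k})"
proof -
  have "(\<Sum>g\<in>carrier \<Gamma>. word_norm g)
    = (\<Sum>k\<in>{0..D}. \<Sum>g\<in>{g \<in> carrier \<Gamma>. word_norm g = k}. word_norm g)"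
    using assms finite_carrier by (intro sum.group[symmetric]) auto
  also have "\<dots> = (\<Sum>k=0..D. k * card {g \<in> carrier \<Gamma>. word_norm g = k})"
    by (intro sum.cong) (auto simp: mult.commute)
  also have "\<dots> = (\<Sum>k=1..D. k * card {g \<in> carrier \<Gamma>. word_norm g = k})"
    by (intro sum.mono_neutral_right) auto
  finally show ?thesis .
qed

lemma short_word_list_shortest_words:
  assumes "bij_betw h {..<card (carrier \<Gamma>)} (carrier \<Gamma>)"
  shows "short_word_list \<C> d (\<lambda>j. shortest_word (h j))"
proof -
  let ?n = "card (carrier \<Gamma>)"
  let ?D = "Max (word_norm ` carrier \<Gamma>)"
  let ?w = "\<lambda>j. shortest_word (h j)"
  have n: "?n > 0"
    using finite_carrier one_closed card_gt_0_iff by blast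
  have "set (?w j) \<subseteq> {1..d}" if "j < ?n" for j
    using that assms shortest_word(1)[of "h j"] by (auto simp: bij_betw_def)
  then have "(\<Sum>i=1..d. symbol_count ?n ?w i) = (\<Sum>j<?n. word_norm (h j))"
    by (rule sum_symbol_count)
  also have "\<dots> = (\<Sum>g\<in>carrier \<Gamma>. word_norm g)"
    using assms by (rule sum.reindex_bij_betw)
  also have "\<dots> = (\<Sum>k=1..?D. k * card {g \<in> carrier \<Gamma>. word_norm g = k})"
    by (rule sum_word_norm) (simp add: finite_carrier)
  finally have count: "(\<Sum>i=1..d. symbol_count ?n ?w i)
    = (\<Sum>k=1..?D. k * card {g \<in> carrier \<Gamma>. word_norm g = k})" .
  have "(\<Sum>i=1..d. real (symbol_count ?n ?w i) / real d)
    = real (\<Sum>i=1..d. symbol_count ?n ?w i) / real d"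
    by (simp add: sum_divide_distrib)
  also have "\<dots> = (\<Sum>k=1..?D. real (k * card {g \<in> carrier \<Gamma>. word_norm g = k}) / real d)"
    unfolding count by (simp add: sum_divide_distrib)
  also have "\<dots> = (\<Sum>k=1..?D. real (k * pairs_at_dist \<C> k) / real (?n * d))"
    unfolding pairs_at_dist_cayley using n by (intro sum.cong) simp_all
  finally show ?thesis
    by (auto simp: short_word_list_def Let_def cayley_digraph_simps diameter_cayley)
qed

end

section \<open>Short spanning factorizations of Cayley digraphs\<close>

text \<open>The word list must begin with the empty word, so the enumeration must begin with \<open>\<one>\<close>.\<close>

lemma ex_bij_betw_nat_finite_starting_at:
  assumes "finite A" and "a \<in> A"
  shows "\<exists>h. bij_betw h {..<card A} A \<and> h 0 = a"
proof -
  obtain f where f: "bij_betw f {..<card A} A"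
    using ex_bij_betw_nat_finite[OF assms(1)] by (auto simp: atLeast0LessThan)
  then have "a \<in> f ` {..<card A}"
    using assms(2) by (simp add: bij_betw_def)
  then obtain k where k: "k < card A" "f k = a"
    by auto
  have "bij_betw (f \<circ> transpose 0 k) {..<card A} A"
    using k(1) by (intro bij_betw_trans[OF _ f]) auto
  then show ?thesis
    using k(2) by (intro exI[of _ "f \<circ> transpose 0 k"]) simp
qed

theorem theorem2:
  fixes \<Gamma> :: "('g, 'm) monoid_scheme" and \<Delta> :: "'g set"
  assumes "group \<Gamma>" and "finite (carrier \<Gamma>)"
    and "\<Delta> \<subseteq> carrier \<Gamma>" and "generate \<Gamma> \<Delta> = carrier \<Gamma>" and "\<one>\<^bsub>\<Gamma>\<^esub> \<notin> \<Delta>"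
  shows "\<exists>d F w. spanning_factorization (cayley_digraph \<Gamma> \<Delta>) d F w \<and>
                 short_word_list (cayley_digraph \<Gamma> \<Delta>) d w"
proof -
  interpret group \<Gamma> by (rule assms(1))
  have "finite \<Delta>"
    using assms(2,3) finite_subset by blast
  then obtain s where s: "bij_betw s {1..card \<Delta>} \<Delta>"
    using ex_bij_betw_nat_finite_1 by blast
  interpret enumerated_generators \<Gamma> \<Delta> "card \<Delta>" s
    using assms(2-4) s by unfold_locales
  obtain h where "bij_betw h {..<card (carrier \<Gamma>)} (carrier \<Gamma>)" "h 0 = \<one>\<^bsub>\<Gamma>\<^esub>"
    using ex_bij_betw_nat_finite_starting_at[OF assms(2) one_closed] by blast
  then show ?thesis
    using spanning_factorization_shortest_words short_word_list_shortest_words by blast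
qed

end
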